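(* Let $b,n$ be nonnegative integers and $1\le u_1<\dots<u_n\le b+2n$ integers, and let $f_{b,n,(u_i)_1^n}(a)=M(V_{a,b,n,(u_i)_1^n})$ for $a\in\mathbb N$. Then $f_{b,n,(u_i)_1^n}(a)$ is a polynomial in $a$, and $$f_{b,n,(u_i)_1^n}(a)=f_{b,n,(u_i)_1^n}(0)\cdot\prod_{i=1}^n (u_i)_{\underline{u_i}}\cdot\frac{P_{|}(a,b+n)}{\prod_{i=1}^n(2a+u_i)_{\underline{u_i}}},$$ where $\underline{u_i}=b+n+i-u_i$.
   Context: Work on the triangular lattice of the plane with some lattice lines horizontal; its unit equilateral triangles are called triangles. A lozenge is the union of two triangles sharing an edge; a lozenge tiling of a region (a union of triangles) is a covering of it by lozenges contained in it with pairwise disjoint interiors, and $M(R)$ denotes the number of lozenge tilings of $R$. $H_{a,b,c,t}$ is the equiangular hexagonal region with side lengths $a,b+t,c,a+t,b,c+t$ read clockwise from the northern (horizontal) side. For $1\le u_1<\dots<u_m\le b+t$ and $1\le v_1<\dots<v_k\le c+t$, $H_{a,b,c,t,(u_i)_1^m,(v_j)_1^k}$ is obtained from $H_{a,b,c,t}$ by removing the $u_i$-th triangle along the northeast side (counting from the north the triangles sharing an edge with that side) for each $i$, and the $v_j$-th triangle along the northwest side (counted likewise) for each $j$. For nonnegative integers $a,b,n$ and $1\le u_1<\dots<u_n\le b+2n$, the region $H_{2a,b,b,2n,(u_i)_1^n,(u_i)_1^n}$ is symmetric about a vertical line $L$, and $V_{a,b,n,(u_i)_1^n}$ is the region of triangles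 of this hexagon whose interiors lie strictly west of $L$. $(x)_k=x(x+1)\cdots(x+k-1)$ is the rising factorial ($(x)_0=1$). $P_{|}(a,b)=\frac{(a+1)_{b-1}}{(2a+1)_{b-1}}\prod_{1\le i\le j\le b-1}\frac{2a+i+j-1}{i+j-1}$ (the number of vertically symmetric tilings of the semiregular hexagon with side lengths $2a,b,b,2a,b,b$). *)

theory Defs
  imports
    Complex_Main
    "HOL-Library.Disjoint_Sets"
    "HOL-Computational_Algebra.Polynomial"
begin

(* The pair (i, j) stands for the lattice point i * (1, 0) + j * (1/2, sqrt 3 / 2). *)
type_synonym point = "int \<times> int"

definition xcoord :: "point \<Rightarrow> real" where
  "xcoord p = real_of_int (fst p) + real_of_int (snd p) / 2"

(* Up i j points north, Down i j points south; both lie in the unit rhombus with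
   south-west corner (i, j), on either side of its diagonal from (i+1, j) to (i, j+1). *)
datatype triangle = Up int int | Down int int

fun corners :: "triangle \<Rightarrow> point set" where
  "corners (Up i j) = {(i, j), (i + 1, j), (i, j + 1)}"
| "corners (Down i j) = {(i + 1, j), (i, j + 1), (i + 1, j + 1)}"

definition share_edge :: "triangle \<Rightarrow> triangle \<Rightarrow> bool" where
  "share_edge s t \<longleftrightarrow> card (corners s \<inter> corners t) = 2"

type_synonym region = "triangle set"

definition lozenge :: "region \<Rightarrow> bool" where
  "lozenge l \<longleftrightarrow> (\<exists>s t. share_edge s t \<and> l = {s, t})"

definition lozenge_tiling :: "region \<Rightarrow> triangle set set \<Rightarrow> bool" where
  "lozenge_tiling R T \<longleftrightarrow> partition_on R T \<and> (\<forall>l\<in>T. lozenge l)"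

definition M :: "region \<Rightarrow> nat" where
  "M R = card {T. lozenge_tiling R T}"

(* The closed hexagon with side lengths a, b+t, c, a+t, b, c+t, clockwise from the northern
   side. Its corners, in the same order starting from the north-west one, are (0, 0), (a, 0),
   (a+b+t, -(b+t)), (a+b+t, -(b+c+t)), (b, -(b+c+t)), (0, -(c+t)). *)
definition hexagon_points :: "nat \<Rightarrow> nat \<Rightarrow> nat \<Rightarrow> nat \<Rightarrow> point set" where
  "hexagon_points a b c t =
     {(i, j). 0 \<le> i \<and> i \<le> int (a + b + t) \<and>
              - int (b + c + t) \<le> j \<and> j \<le> 0 \<and>
              - int (c + t) \<le> i + j \<and> i + j \<le> int a}"

(* By convexity of the hexagon, a triangle lies in it iff its corners do. *)
definition hexagon :: "nat \<Rightarrow> nat \<Rightarrow> nat \<Rightarrow> nat \<Rightarrow> region" where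
  "hexagon a b c t = {s. corners s \<subseteq> hexagon_points a b c t}"

(* The k-th triangle (k = 1, 2, ... from the north) inside the hexagon along its north-east
   side, which starts at (a, 0), respectively its north-west side, which starts at (0, 0). *)
definition ne_triangle :: "nat \<Rightarrow> nat \<Rightarrow> triangle" where
  "ne_triangle a k = Up (int a + int k - 1) (- int k)"

definition nw_triangle :: "nat \<Rightarrow> triangle" where
  "nw_triangle k = Up 0 (- int k)"

lemma ne_triangle_edge:
  assumes "1 \<le> k" "k \<le> b + t" "0 < a + c + t"
  shows "ne_triangle a k \<in> hexagon a b c t"
    and "{(int a + int k - 1, 1 - int k), (int a + int k, - int k)} \<subseteq> corners (ne_triangle a k)"
  using assms by (simp_all add: ne_triangle_def hexagon_def hexagon_points_def, linarith)

lemma nw_triangle_edge: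
  assumes "1 \<le> k" "k \<le> c + t" "0 < a + b + t"
  shows "nw_triangle k \<in> hexagon a b c t"
    and "{(0, 1 - int k), (0, - int k)} \<subseteq> corners (nw_triangle k)"
  using assms by (simp_all add: nw_triangle_def hexagon_def hexagon_points_def, linarith)

definition dented_hexagon ::
  "nat \<Rightarrow> nat \<Rightarrow> nat \<Rightarrow> nat \<Rightarrow> nat \<Rightarrow> (nat \<Rightarrow> nat) \<Rightarrow> nat \<Rightarrow> (nat \<Rightarrow> nat) \<Rightarrow> region" where
  "dented_hexagon a b c t m u k v =
     hexagon a b c t - (\<lambda>i. ne_triangle a (u i)) ` {1..m} - (\<lambda>j. nw_triangle (v j)) ` {1..k}"

(* The symmetry axis of the hexagon passes through the midpoint (a, 0) of its northern side,
   which has length 2 * a. The interior of a triangle lies strictly west of this line iff all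
   corners lie weakly west of it. *)
definition V :: "nat \<Rightarrow> nat \<Rightarrow> nat \<Rightarrow> (nat \<Rightarrow> nat) \<Rightarrow> region" where
  "V a b n u = {s \<in> dented_hexagon (2 * a) b b (2 * n) n u n u.
                  \<forall>p\<in>corners s. xcoord p \<le> xcoord (int a, 0)}"

(* For b = 0 the natural subtraction b - 1 = 0 gives the value 1, the number of tilings of
   the degenerate hexagon; the rising factorials of index -1 are not to be read literally. *)
definition P_vert :: "nat \<Rightarrow> nat \<Rightarrow> real" where
  "P_vert a b =
     pochhammer (real a + 1) (b - 1) / pochhammer (2 * real a + 1) (b - 1) *
     (\<Prod>j = 1..b - 1. \<Prod>i = 1..j.
        (2 * real a + real i + real j - 1) / (real i + real j - 1))"

(* The subtraction never truncates: u i \<le> b + n + i if 1 \<le> u 1 < ... < u n \<le> b + 2 * n. *)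
definition underl :: "nat \<Rightarrow> nat \<Rightarrow> (nat \<Rightarrow> nat) \<Rightarrow> nat \<Rightarrow> nat" where
  "underl b n u i = b + n + i - u i"

end

(*
Cutting along the lines parallel to the northwest side turns the tilings into m = b + n
nonintersecting lattice paths from the undented edges p of that side to the zigzag along the axis,
so their number f(a) is the determinant of the binomials C(a+c, 2c+1-p), 0 <= c < m, which is a
polynomial in a. Instead of invoking the lemma of Lindstroem, Gessel and Viennot, the tilings are
counted from west to east: by Pascal's rule, covering one upward triangle expands one row of the
determinant into two, and a coincidence of two rows corresponds to a triangle already taken.

For fixed c, the number (p)_{2a} C(a+c, 2c+1-p) is the coefficient of x^(p-1) in the 2a-th
derivative of (x(1+x))^(a+c). In y = x + 1/2 these derivatives are even polynomials of degree 2c,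
so for every a they span the same space, by triangular combinations with diagonal (2c+1)_{2a}
relative to a = 0. Hence f(a) prod_p (p)_{2a} = f(0) prod_c (2c+1)_{2a}, and the product on the
right is P(a,m) (1)_{2a} ... (m)_{2a}.
*)
theory Submission
  imports Defs "Jordan_Normal_Form.Determinant"
begin

section \<open>Removing lozenges from a region\<close>

lemma share_edge_Up:
  "share_edge (Up i j) t \<longleftrightarrow> t = Down i j \<or> t = Down i (j - 1) \<or> t = Down (i - 1) j"
  by (cases t) (auto simp: share_edge_def Int_insert_left)

lemma share_edge_Down:
  "share_edge (Down i j) t \<longleftrightarrow> t = Up i j \<or> t = Up i (j + 1) \<or> t = Up (i + 1) j"
  by (cases t) (auto simp: share_edge_def Int_insert_left)

lemma share_edge_sym: "share_edge s t \<longleftrightarrow> share_edge t s"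
  by (simp add: share_edge_def Int_commute)

lemma finite_tilings: "finite R \<Longrightarrow> finite {T. lozenge_tiling R T}"
  by (rule finite_subset[OF _ finitely_many_partition_on]) (auto simp: lozenge_tiling_def)

lemma M_empty [simp]: "M {} = 1"
proof -
  have "{T. lozenge_tiling {} T} = {{}}"
    by (auto simp: lozenge_tiling_def partition_on_empty)
  then show ?thesis by (simp add: M_def)
qed

lemma tilings_containing:
  assumes "s \<in> R" "t \<in> R" "share_edge s t"
  shows "{T. lozenge_tiling R T \<and> {s, t} \<in> T} = insert {s, t} ` {T. lozenge_tiling (R - {s, t}) T}"
proof safe
  fix T assume T: "lozenge_tiling R T" "{s, t} \<in> T"
  have d: "disjnt {s, t} (\<Union>(T - {{s, t}}))"
    using T unfolding lozenge_tiling_def partition_on_def disjnt_def disjoint_def by fastforce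
  have "insert {s, t} (T - {{s, t}}) = T" using T(2) by auto
  then have "lozenge_tiling (R - {s, t}) (T - {{s, t}})"
    using T(1) partition_on_insert[OF d, of R] by (auto simp: lozenge_tiling_def)
  then show "T \<in> insert {s, t} ` {T. lozenge_tiling (R - {s, t}) T}"
    using T(2) by (intro image_eqI[of _ _ "T - {{s, t}}"]) auto
next
  fix T assume T: "lozenge_tiling (R - {s, t}) T"
  then have "disjnt {s, t} (\<Union>T)"
    by (auto simp: lozenge_tiling_def partition_on_def disjnt_def)
  from partition_on_insert[OF this, of R] T assms
  show "lozenge_tiling R (insert {s, t} T)"
    unfolding lozenge_tiling_def lozenge_def by auto
qed

lemma M_containing:
  assumes "s \<in> R" "t \<in> R" "share_edge s t"
  shows "card {T. lozenge_tiling R T \<and> {s, t} \<in> T} = M (R - {s, t})"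
proof -
  have "inj_on (insert {s, t}) {T. lozenge_tiling (R - {s, t}) T}"
  proof (rule inj_onI)
    fix T T'
    assume "T \<in> {T. lozenge_tiling (R - {s, t}) T}" "T' \<in> {T. lozenge_tiling (R - {s, t}) T}"
      "insert {s, t} T = insert {s, t} T'"
    moreover have "{s, t} \<notin> T" if "lozenge_tiling (R - {s, t}) T" for T
      using that by (auto simp: lozenge_tiling_def partition_on_def)
    ultimately show "T = T'" by (metis insert_ident mem_Collect_eq)
  qed
  then show ?thesis
    by (simp add: tilings_containing[OF assms] M_def card_image)
qed

lemma M_peel:
  assumes "finite R" "s \<in> R"
  shows "M R = (\<Sum>t | t \<in> R \<and> share_edge s t. M (R - {s, t}))"
proof -
  let ?N = "{t. t \<in> R \<and> share_edge s t}"
  have "{T. lozenge_tiling R T} = (\<Union>t\<in>?N. {T. lozenge_tiling R T \<and> {s, t} \<in> T})"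
  proof safe
    fix T assume T: "lozenge_tiling R T"
    then obtain l where l: "l \<in> T" "s \<in> l"
      using assms(2) by (auto simp: lozenge_tiling_def partition_on_def)
    then have "lozenge l" using T by (auto simp: lozenge_tiling_def)
    then obtain t where t: "share_edge s t" "l = {s, t}"
      using l(2) unfolding lozenge_def by (metis empty_iff insert_commute insert_iff share_edge_sym)
    moreover have "t \<in> R" using T t(2) l(1) by (auto simp: lozenge_tiling_def partition_on_def)
    ultimately show "T \<in> (\<Union>t\<in>?N. {T. lozenge_tiling R T \<and> {s, t} \<in> T})"
      using T l(1) by auto
  qed
  then have "M R = card (\<Union>t\<in>?N. {T. lozenge_tiling R T \<and> {s, t} \<in> T})"
    by (simp add: M_def)
  also have "\<dots> = (\<Sum>t\<in>?N. card {T. lozenge_tiling R T \<and> {s, t} \<in> T})"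
  proof (rule card_UN_disjoint)
    show "finite ?N" using assms(1) by simp
    show "\<forall>t\<in>?N. finite {T. lozenge_tiling R T \<and> {s, t} \<in> T}"
      using finite_subset[OF _ finite_tilings[OF assms(1)]] by blast
    show "\<forall>t\<in>?N. \<forall>t'\<in>?N. t \<noteq> t' \<longrightarrow>
        {T. lozenge_tiling R T \<and> {s, t} \<in> T} \<inter> {T. lozenge_tiling R T \<and> {s, t'} \<in> T} = {}"
    proof safe
      fix t t' T
      assume T: "lozenge_tiling R T" "{s, t} \<in> T" "{s, t'} \<in> T" and "t \<noteq> t'"
      then have "{s, t} \<noteq> {s, t'}" by (auto simp: doubleton_eq_iff)
      moreover have "disjoint T" using T(1) by (auto simp: lozenge_tiling_def partition_on_def)
      ultimately have "{s, t} \<inter> {s, t'} = {}" using T(2,3) by (auto dest: disjointD)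
      then show "T \<in> {}" by simp
    qed
  qed
  also have "\<dots> = (\<Sum>t\<in>?N. M (R - {s, t}))"
    by (rule sum.cong) (auto simp: M_containing assms(2))
  finally show ?thesis .
qed

lemma M_no_neighbour:
  assumes "finite R" "s \<in> R" "\<And>t. t \<in> R \<Longrightarrow> \<not> share_edge s t"
  shows "M R = 0"
proof -
  have "{t. t \<in> R \<and> share_edge s t} = {}" using assms(3) by auto
  then show ?thesis unfolding M_peel[OF assms(1,2)] by (simp only: sum.empty)
qed

text \<open>A triangle with a single neighbour left must be paired with it. Injectivity of
  \<open>f\<close> keeps the partners of the other triangles available when one pair is
  removed.\<close>

lemma M_forced:
  assumes "finite X" "finite R" "inj_on f X" "X \<subseteq> R" "f ` X \<subseteq> R" "X \<inter> f ` X = {}"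
    and "\<And>x t. x \<in> X \<Longrightarrow> t \<in> R \<Longrightarrow> share_edge x t \<longleftrightarrow> t = f x"
  shows "M R = M (R - X - f ` X)"
  using assms
proof (induction X arbitrary: R rule: finite_induct)
  case empty
  then show ?case by simp
next
  case (insert x X)
  have "{t. t \<in> R \<and> share_edge x t} = {f x}" using insert.prems by auto
  then have "M R = M (R - {x, f x})"
    using M_peel[of R x] insert.prems by simp
  also have "\<dots> = M (R - {x, f x} - X - f ` X)"
  proof (rule insert.IH)
    show "f ` X \<subseteq> R - {x, f x}" using insert.prems insert.hyps by (auto simp: inj_on_def)
    show "share_edge y t \<longleftrightarrow> t = f y" if "y \<in> X" "t \<in> R - {x, f x}" for y t
      using that insert.prems(6)[of y t] by auto
  qed (use insert.prems insert.hyps in \<open>auto simp: inj_on_def\<close>)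
  also have "R - {x, f x} - X - f ` X = R - insert x X - f ` insert x X" by auto
  finally show ?case .
qed

section \<open>Determinants of lists of rows\<close>

text \<open>With rows as functions of the column index, the number of rows alone fixes the size, and
  list concatenation locates the row that a step changes.\<close>

definition rows_mat :: "(nat \<Rightarrow> 'a) list \<Rightarrow> 'a mat" where
  "rows_mat rs = mat (length rs) (length rs) (\<lambda>(k, c). (rs ! k) c)"

definition rows_det :: "(nat \<Rightarrow> 'a :: comm_ring_1) list \<Rightarrow> 'a" where
  "rows_det rs = det (rows_mat rs)"

lemma rows_mat_carrier [simp]: "rows_mat rs \<in> carrier_mat (length rs) (length rs)"
  by (simp add: rows_mat_def)

lemma rows_det_leibniz:
  "rows_det rs = (\<Sum>p | p permutes {0..<length rs}. signof p * (\<Prod>k = 0..<length rs. (rs ! k) (p k)))"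
  unfolding rows_det_def det_def'[OF rows_mat_carrier]
  by (intro sum.cong refl arg_cong2[of _ _ _ _ "(*)"] prod.cong)
    (auto simp: rows_mat_def permutes_in_image)

lemma rows_det_cong:
  assumes "length rs = length rs'" "\<And>k c. k < length rs \<Longrightarrow> c < length rs \<Longrightarrow> (rs ! k) c = (rs' ! k) c"
  shows "rows_det rs = rows_det rs'"
  using assms by (auto simp: rows_det_def rows_mat_def intro!: arg_cong[of _ _ det] eq_matI)

lemma rows_det_add:
  "rows_det (xs @ (\<lambda>c. f c + g c) # ys) = rows_det (xs @ f # ys) + rows_det (xs @ g # ys)"
proof -
  let ?n = "Suc (length xs + length ys)"
  \<comment> \<open>The remaining rows are written with \<open>f\<close> in the exchanged place,
    which gives one cofactor product common to \<open>f\<close>, \<open>g\<close> and their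
    sum.\<close>
  have *: "(\<Prod>k = 0..<?n. ((xs @ h # ys) ! k) (p k)) =
      h (p (length xs)) * (\<Prod>k \<in> {0..<?n} - {length xs}. ((xs @ f # ys) ! k) (p k))" for h p
  proof -
    have "(\<Prod>k = 0..<?n. ((xs @ h # ys) ! k) (p k)) = ((xs @ h # ys) ! length xs) (p (length xs)) *
        (\<Prod>k \<in> {0..<?n} - {length xs}. ((xs @ h # ys) ! k) (p k))"
      by (rule prod.remove) auto
    also have "(\<Prod>k \<in> {0..<?n} - {length xs}. ((xs @ h # ys) ! k) (p k)) =
        (\<Prod>k \<in> {0..<?n} - {length xs}. ((xs @ f # ys) ! k) (p k))"
      by (rule prod.cong) (auto simp: nth_append nth_Cons')
    finally show ?thesis by simp
  qed
  have "rows_det (xs @ h # ys) = (\<Sum>p | p permutes {0..<?n}. signof p *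
      (h (p (length xs)) * (\<Prod>k \<in> {0..<?n} - {length xs}. ((xs @ f # ys) ! k) (p k))))" for h
  proof -
    have "length (xs @ h # ys) = ?n" by simp
    then show ?thesis by (simp only: rows_det_leibniz *[of h])
  qed
  then show ?thesis
    by (simp add: sum.distrib[symmetric] algebra_simps del: sum.distrib)
qed

lemma rows_det_dup:
  assumes "f \<in> set ys"
  shows "rows_det (xs @ f # ys) = 0"
proof -
  obtain j where j: "j < length ys" "ys ! j = f" using assms by (auto simp: in_set_conv_nth)
  show ?thesis unfolding rows_det_def
    by (rule det_identical_rows[OF rows_mat_carrier, of "length xs" "length xs + Suc j"])
      (use j in \<open>auto simp: rows_mat_def nth_append\<close>)
qed

lemma rows_det_zero_row:
  assumes "f \<in> set rs" "\<And>c. c < length rs \<Longrightarrow> f c = 0"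
  shows "rows_det rs = 0"
proof -
  obtain k where k: "k < length rs" "rs ! k = f" using assms by (auto simp: in_set_conv_nth)
  have "(\<Prod>k = 0..<length rs. (rs ! k) (p k)) = 0" if "p permutes {0..<length rs}" for p
    using k assms(2)[of "p k"] permutes_in_image[OF that, of k] by (intro prod_zero) auto
  then show ?thesis by (simp add: rows_det_leibniz)
qed

lemma rows_det_zero_col:
  assumes "c < length rs" "\<And>f. f \<in> set rs \<Longrightarrow> f c = 0"
  shows "rows_det rs = 0"
proof -
  have "(\<Prod>k = 0..<length rs. (rs ! k) (p k)) = 0" if p: "p permutes {0..<length rs}" for p
  proof -
    have "c \<in> p ` {0..<length rs}" using permutes_image[OF p] assms(1) by simp
    then obtain k where "k < length rs" "p k = c" by auto
    then show ?thesis using assms(2)[of "rs ! k"] by (intro prod_zero) auto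
  qed
  then show ?thesis by (simp add: rows_det_leibniz)
qed

lemma rows_det_upper_triangular:
  assumes "\<And>k c. c < k \<Longrightarrow> k < length rs \<Longrightarrow> (rs ! k) c = 0"
  shows "rows_det rs = (\<Prod>k < length rs. (rs ! k) k)"
proof -
  have "rows_det rs = prod_list (diag_mat (rows_mat rs))"
    unfolding rows_det_def
    by (rule det_upper_triangular[OF _ rows_mat_carrier]) (use assms in \<open>auto simp: rows_mat_def\<close>)
  also have "\<dots> = (\<Prod>k < length rs. (rs ! k) k)"
    by (simp add: diag_mat_def rows_mat_def prod.list_conv_set_nth atLeast0LessThan)
  finally show ?thesis .
qed

lemma rows_det_scale:
  "rows_det (map (\<lambda>x c. h x * f x c) xs) = (\<Prod>x\<leftarrow>xs. h x) * rows_det (map f xs)"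
proof -
  have "(\<Prod>k = 0..<length xs. h (xs ! k)) = (\<Prod>x\<leftarrow>xs. h x)"
    by (simp add: prod.list_conv_set_nth)
  then show ?thesis
    by (simp add: rows_det_leibniz prod.distrib sum_distrib_left mult_ac)
qed

text \<open>The matrix of \<open>f\<close> is that of \<open>g\<close> times the triangular matrix
  \<open>T\<close>, whose determinant is its diagonal product.\<close>

lemma rows_det_column_ops:
  fixes f g :: "'b \<Rightarrow> nat \<Rightarrow> 'a :: comm_ring_1"
  assumes "\<And>x c. x \<in> set xs \<Longrightarrow> c < length xs \<Longrightarrow> f x c = (\<Sum>d<length xs. g x d * T d c)"
    and "\<And>d c. c < d \<Longrightarrow> T d c = 0"
  shows "rows_det (map f xs) = rows_det (map g xs) * (\<Prod>c<length xs. T c c)"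
proof -
  let ?n = "length xs"
  let ?T = "map (\<lambda>d c. T d c) [0..<?n]"
  have "rows_mat (map f xs) = rows_mat (map g xs) * rows_mat ?T"
    by (rule eq_matI)
      (auto simp: rows_mat_def scalar_prod_def assms(1) atLeast0LessThan intro!: sum.cong)
  then have "rows_det (map f xs) = rows_det (map g xs) * rows_det ?T"
    unfolding rows_det_def
    using det_mult[of "rows_mat (map g xs)" ?n "rows_mat ?T"] by (simp add: rows_mat_def)
  also have "rows_det ?T = (\<Prod>c<?n. T c c)"
    by (subst rows_det_upper_triangular) (auto simp: assms(2))
  finally show ?thesis .
qed

section \<open>Counting the tilings strip by strip\<close>

text \<open>The pair \<open>e = (i, p)\<close> is the lattice edge from \<open>(i, - p)\<close> to \<open>(i, 1 - p)\<close>, and \<open>wt a m e c\<close> is the number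
  of paths from it to the \<open>c\<close>-th such edge \<open>(a + c, 2 * c + 1)\<close> of the zigzag along the axis; a path step
  increases \<open>i\<close> by one and \<open>p\<close> by zero or one. Columns \<open>c \<ge> m\<close> are zero, so that a matrix with more
  than \<open>m\<close> rows is singular.\<close>

definition wt :: "nat \<Rightarrow> nat \<Rightarrow> nat \<times> nat \<Rightarrow> nat \<Rightarrow> real" where
  "wt a m e c = (if c < m \<and> fst e \<le> a + c \<and> snd e \<le> 2 * c + 1
     then real ((a + c - fst e) choose (2 * c + 1 - snd e)) else 0)"

lemma wt_pascal:
  assumes "2 * i + 2 \<le> 2 * a + p"
  shows "wt a m (i, p) c = wt a m (Suc i, p) c + wt a m (Suc i, Suc p) c"
proof (cases "c < m \<and> i \<le> a + c \<and> p \<le> 2 * c + 1")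
  case True
  \<comment> \<open>Since p \<le> 2c + 1, the assumption puts the edge strictly before the end, so
    every path has a first step to split on.\<close>
  have "i < a + c" using True assms by linarith
  then obtain d where d: "a + c - i = Suc d" "a + c - Suc i = d" by (metis Suc_diff_Suc)
  show ?thesis
  proof (cases "p = 2 * c + 1")
    case True
    then show ?thesis using d \<open>i < a + c\<close> by (simp add: wt_def)
  next
    case False
    then obtain r where "2 * c + 1 - p = Suc r" "2 * c + 1 - Suc p = r"
      using True by (metis Suc_diff_Suc le_neq_implies_less)
    then show ?thesis using d \<open>i < a + c\<close> True False by (simp add: wt_def)
  qed
next
  case False
  then show ?thesis by (auto simp: wt_def)
qed

section \<open>Row coordinates for triangles and the partially tiled regions\<close>

definition up :: "nat \<Rightarrow> nat \<Rightarrow> triangle" where "up i p = Up (int i) (- int p)"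
definition down :: "nat \<Rightarrow> nat \<Rightarrow> triangle" where "down i q = Down (int i) (- int q)"

lemma up_down_simps [simp]:
  "up i p = up i' p' \<longleftrightarrow> i = i' \<and> p = p'"
  "down i p = down i' p' \<longleftrightarrow> i = i' \<and> p = p'"
  "up i p \<noteq> down i' p'" "down i p \<noteq> up i' p'"
  by (auto simp: up_def down_def)

lemma share_edge_up_down [simp]:
  "\<not> share_edge (up i p) (up i' p')"
  "\<not> share_edge (down i q) (down i' q')"
  "share_edge (up i p) (down i' q) \<longleftrightarrow> i' = i \<and> (q = p \<or> q = Suc p) \<or> Suc i' = i \<and> q = p"
  "share_edge (down i' q) (up i p) \<longleftrightarrow> i' = i \<and> (q = p \<or> q = Suc p) \<or> Suc i' = i \<and> q = p"
  by (auto simp: up_def down_def share_edge_Up share_edge_Down)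

text \<open>The rows of the upward and of the downward triangles of the strip between the lines \<open>i\<close> and
  \<open>i + 1\<close> in the undented half hexagon with northern side \<open>a\<close>, northwest side \<open>N\<close> and height \<open>2 * m\<close>.\<close>

definition urows :: "nat \<Rightarrow> nat \<Rightarrow> nat \<Rightarrow> nat \<Rightarrow> nat set" where
  "urows a m N i = {p. 1 \<le> p \<and> p \<le> 2 * m \<and> p \<le> i + N \<and> 2 * i + 2 \<le> 2 * a + p}"

definition drows :: "nat \<Rightarrow> nat \<Rightarrow> nat \<Rightarrow> nat \<Rightarrow> nat set" where
  "drows a m N i = {q. 1 \<le> q \<and> q \<le> 2 * m \<and> q \<le> Suc i + N \<and> 2 * i + 3 \<le> 2 * a + q}"

definition later :: "nat \<Rightarrow> nat \<Rightarrow> nat \<Rightarrow> nat \<Rightarrow> region" where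
  "later a m N i = {up i' p | i' p. i < i' \<and> p \<in> urows a m N i'} \<union>
     {down i' q | i' q. i < i' \<and> q \<in> drows a m N i'}"

text \<open>What remains when the strips before \<open>i\<close> are tiled, in strip \<open>i\<close> exactly the upward triangles in
  the rows \<open>A\<close> are still uncovered, and the downward ones in the rows \<open>B\<close> are already covered.\<close>

definition reg :: "nat \<Rightarrow> nat \<Rightarrow> nat \<Rightarrow> nat \<Rightarrow> nat set \<Rightarrow> nat set \<Rightarrow> region" where
  "reg a m N i A B = up i ` A \<union> down i ` (drows a m N i - B) \<union> later a m N i"

text \<open>The zigzag edges on the lines up to \<open>i\<close>. Paths that have ended stay in the determinant as the
  corresponding unit rows.\<close>

definition terms :: "nat \<Rightarrow> nat \<Rightarrow> nat \<Rightarrow> (nat \<times> nat) list" where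
  "terms a m i = map (\<lambda>c. (a + c, 2 * c + 1)) [0..<min m (Suc i - a)]"

text \<open>A state in the middle of a strip: ended paths, edges awaiting their step, edges that
  have made it. The paths are listed from north to south, so no signs arise.\<close>

definition state_det :: "nat \<Rightarrow> nat \<Rightarrow> nat \<Rightarrow> nat list \<Rightarrow> nat list \<Rightarrow> real" where
  "state_det a m i xs ys =
     rows_det (map (wt a m) (terms a m i @ map (Pair i) xs @ map (Pair (Suc i)) ys))"

lemma rows_bounds: "p \<in> urows a m N i \<Longrightarrow> i < a + m" "q \<in> drows a m N i \<Longrightarrow> Suc i < a + m"
  by (auto simp: urows_def drows_def)

lemma finite_rows [simp]: "finite (urows a m N i)" "finite (drows a m N i)"
  by (rule finite_subset[of _ "{..2 * m}"]; auto simp: urows_def drows_def)+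

lemma later_iff:
  "up i' p \<in> later a m N i \<longleftrightarrow> i < i' \<and> p \<in> urows a m N i'"
  "down i' p \<in> later a m N i \<longleftrightarrow> i < i' \<and> p \<in> drows a m N i'"
  by (auto simp: later_def)

lemma later_Suc:
  "later a m N i =
     up (Suc i) ` urows a m N (Suc i) \<union> down (Suc i) ` drows a m N (Suc i) \<union> later a m N (Suc i)"
proof (rule Set.set_eqI)
  fix t
  have *: "i < j \<longleftrightarrow> j = Suc i \<or> Suc i < j" for j by auto
  have "t \<in> later a m N i \<longleftrightarrow> (\<exists>i' p. t = up i' p \<and> (i' = Suc i \<or> Suc i < i') \<and> p \<in> urows a m N i') \<or>
      (\<exists>i' p. t = down i' p \<and> (i' = Suc i \<or> Suc i < i') \<and> p \<in> drows a m N i')"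
    unfolding later_def *[symmetric] by blast
  then show "t \<in> later a m N i \<longleftrightarrow> t \<in> up (Suc i) ` urows a m N (Suc i) \<union>
      down (Suc i) ` drows a m N (Suc i) \<union> later a m N (Suc i)"
    unfolding later_def by blast
qed

lemma finite_reg: "finite A \<Longrightarrow> finite (reg a m N i A B)"
proof -
  assume "finite A"
  have "later a m N i \<subseteq> case_prod up ` ({..<a + m} \<times> {..2 * m}) \<union> case_prod down ` ({..<a + m} \<times> {..2 * m})"
    using rows_bounds by (fastforce simp: later_def urows_def drows_def)
  then have "finite (later a m N i)" by (rule finite_subset) auto
  then show ?thesis using \<open>finite A\<close> by (simp add: reg_def)
qed

text \<open>The later end is c - c' steps away but 2(c - c') rows further south, and a step gains at
  most one row.\<close>

lemma wt_terminal: "c' < c \<Longrightarrow> wt a m (a + c', Suc (2 * c')) c = 0"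
  by (auto simp: wt_def)

lemma reg_beyond_end:
  assumes "a + m \<le> i"
  shows "reg a m N i {} {} = {}"
  using assms rows_bounds by (fastforce simp: reg_def later_def)

lemma rows_det_terms: "rows_det (map (wt a m) (map (\<lambda>c. (a + c, 2 * c + 1)) [0..<m])) = 1"
  by (subst rows_det_upper_triangular) (auto simp: wt_def)

text \<open>Each upward triangle of a strip is matched with the downward triangle of its own row or of the
  next row; this is Pascal's rule for its row of the determinant.\<close>

lemma strip_expand:
  assumes base: "\<And>ys. \<lbrakk>sorted_wrt (<) ys; set ys \<subseteq> drows a m N i;
      length (terms a m i) + length ys = S\<rbrakk> \<Longrightarrow> real (M (reg a m N i {} (set ys))) = state_det a m i [] ys"
    and "sorted_wrt (<) (xs @ ys)" "set xs \<subseteq> urows a m N i" "set ys \<subseteq> drows a m N i"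
    and "length (terms a m i) + length xs + length ys = S"
  shows "real (M (reg a m N i (set xs) (set ys))) = state_det a m i xs ys"
  using assms(2-5)
proof (induction xs arbitrary: ys rule: rev_induct)
  case Nil
  then show ?case using base[of ys] by simp
next
  case (snoc x xs)
  let ?R = "reg a m N i (set (xs @ [x])) (set ys)"
  let ?D = "drows a m N i - set ys"
  let ?d = "\<lambda>y. rows_det (map (wt a m) (terms a m i @ map (Pair i) xs @ map (Pair (Suc i)) (y # ys)))"
  let ?t = "\<lambda>y. if y \<in> ?D then real (M (?R - {up i x, down i y})) else 0"
  have x: "x \<in> urows a m N i" and less: "\<forall>z\<in>set xs. z < x" "\<forall>y\<in>set ys. x < y"
    using snoc.prems by (auto simp: sorted_wrt_append)
  have fin: "finite ?R" by (simp add: finite_reg)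
  \<comment> \<open>The third neighbour of \<open>up i x\<close> belongs to strip i - 1, which is
    already tiled.\<close>
  have nbr: "{t. t \<in> ?R \<and> share_edge (up i x) t} = down i ` ({x, Suc x} \<inter> ?D)"
    by (auto simp: reg_def later_def)
  have "M ?R = (\<Sum>t\<in>down i ` ({x, Suc x} \<inter> ?D). M (?R - {up i x, t}))"
    using M_peel[OF fin, of "up i x"] nbr by (simp add: reg_def)
  also have "\<dots> = (\<Sum>y\<in>{x, Suc x} \<inter> ?D. M (?R - {up i x, down i y}))"
    by (rule sum.reindex_cong[of "down i"]) (auto simp: inj_on_def)
  also have "real \<dots> = ?t x + ?t (Suc x)"
    by (simp add: Int_insert_left)
  finally have M: "real (M ?R) = ?t x + ?t (Suc x)" .
  have D: "state_det a m i (xs @ [x]) ys = ?d x + ?d (Suc x)"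
  proof -
    have "wt a m (i, x) = (\<lambda>c. wt a m (Suc i, x) c + wt a m (Suc i, Suc x) c)"
      using x by (intro ext wt_pascal) (auto simp: urows_def)
    then show ?thesis
      using rows_det_add[of "map (wt a m) (terms a m i @ map (Pair i) xs)"]
      by (simp add: state_det_def)
  qed
  have step: "?t y = ?d y" if y: "y = x \<or> y = Suc x" for y
  proof (cases "y \<in> ?D")
    case True
    have "?R - {up i x, down i y} = reg a m N i (set xs) (set (y # ys))"
      using less by (auto simp: reg_def later_def)
    moreover have "real (M (reg a m N i (set xs) (set (y # ys)))) = state_det a m i xs (y # ys)"
    proof (rule snoc.IH)
      \<comment> \<open>As y \<le> x + 1, no entry of \<open>ys\<close> is smaller than
        \<open>y\<close>, and \<open>y\<close> itself is not among them.\<close>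
      have "\<forall>z\<in>set ys. y < z" using y less(2) True by (metis DiffD2 Suc_lessI)
      then show "sorted_wrt (<) (xs @ y # ys)"
        using snoc.prems(1) y less by (auto simp: sorted_wrt_append less_Suc_eq)
    qed (use snoc.prems True in auto)
    ultimately show ?thesis using True by (simp add: state_det_def)
  next
    case False
    have zero: "?d y = 0"
    proof (cases "y \<in> set ys")
      case True
      then show ?thesis
        using rows_det_dup[of "wt a m (Suc i, y)" "map (wt a m) (map (Pair (Suc i)) ys)"
            "map (wt a m) (terms a m i @ map (Pair i) xs)"] by simp
    next
      case nin: False
      have "wt a m (Suc i, y) c = 0" for c
      proof -
        \<comment> \<open>Either the row lies south of the region, beyond all ends, or the edge has
          crossed the axis: an end k steps away would then be 2k + 1 rows further south.\<close>
        consider "y = Suc (2 * m)" | "2 * a + y = 2 * i + 2"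
          using x y False nin by (force simp: urows_def drows_def)
        then show ?thesis by cases (auto simp: wt_def binomial_eq_0_iff)
      qed
      then show ?thesis by (intro rows_det_zero_row[of "wt a m (Suc i, y)"]) auto
    qed
    show ?thesis by (simp only: False zero if_False)
  qed
  show ?case unfolding M D by (simp only: step[OF disjI1[OF refl]] step[OF disjI2[OF refl]])
qed

text \<open>Once its upward triangles are covered, the remaining downward triangles of a strip can only be
  matched with their eastern neighbours.\<close>

lemma strip_forced:
  assumes "B \<subseteq> drows a m N i" "drows a m N i - B \<subseteq> urows a m N (Suc i)"
  shows "M (reg a m N i {} B) = M (reg a m N (Suc i) (B \<inter> urows a m N (Suc i)) {})"
proof -
  define f where "f t = (case t of Down i j \<Rightarrow> Up (i + 1) j | Up i j \<Rightarrow> Up i j)" for t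
  have f: "f (down i q) = up (Suc i) q" for q
    by (simp add: f_def up_def down_def)
  let ?X = "down i ` (drows a m N i - B)"
  have fX: "f ` ?X = up (Suc i) ` (drows a m N i - B)"
    by (auto simp: image_image f)
  have sub: "urows a m N (Suc i) \<subseteq> drows a m N i"
    by (auto simp: urows_def drows_def)
  have "M (reg a m N i {} B) = M (reg a m N i {} B - ?X - f ` ?X)"
  proof (rule M_forced)
    show "inj_on f ?X" by (auto simp: inj_on_def f)
    show "f ` ?X \<subseteq> reg a m N i {} B"
      unfolding fX using assms(2) by (auto simp: reg_def later_def)
    show "share_edge x t \<longleftrightarrow> t = f x" if "x \<in> ?X" "t \<in> reg a m N i {} B" for x t
      using that by (auto simp: reg_def later_def f)
  qed (auto simp: fX finite_reg, auto simp: reg_def)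
  also have "reg a m N i {} B - ?X - f ` ?X = reg a m N (Suc i) (B \<inter> urows a m N (Suc i)) {}"
    unfolding fX
    unfolding reg_def later_Suc[of a m N i] using assms sub by (auto simp: later_iff)
  finally show ?thesis .
qed

text \<open>The leftover downward triangles go to their eastern neighbours. Only the triangle at a
  zigzag edge has none: it must be covered already, and its path ends there.\<close>

lemma strip_finish:
  assumes IH: "\<And>xs. \<lbrakk>sorted_wrt (<) xs; set xs \<subseteq> urows a m N (Suc i);
      length (terms a m (Suc i)) + length xs = S\<rbrakk> \<Longrightarrow>
      real (M (reg a m N (Suc i) (set xs) {})) = state_det a m (Suc i) xs []"
    and "m \<le> S" "m \<le> N" "sorted_wrt (<) ys" "set ys \<subseteq> drows a m N i"
    and "length (terms a m i) + length ys = S"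
  shows "real (M (reg a m N i {} (set ys))) = state_det a m i [] ys"
proof (cases "a \<le> Suc i \<and> Suc i < a + m")
  case True
  then obtain c where c: "Suc i = a + c" "c < m" by (metis add_less_cancel_left le_iff_add)
  let ?q = "2 * c + 1"
  have q: "?q \<in> drows a m N i" using c assms(3) by (auto simp: drows_def)
  have rest: "y \<in> urows a m N (Suc i) \<longleftrightarrow> y \<noteq> ?q" "?q \<le> y" if "y \<in> drows a m N i" for y
    using that c by (auto simp: urows_def drows_def)
  have terms: "terms a m i = map (\<lambda>c. (a + c, 2 * c + 1)) [0..<c]"
    "terms a m (Suc i) = terms a m i @ [(Suc i, ?q)]"
  proof -
    have "min m (Suc i - a) = c" "min m (Suc (Suc i) - a) = Suc c" using c by auto
    then show "terms a m i = map (\<lambda>c. (a + c, 2 * c + 1)) [0..<c]"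
      "terms a m (Suc i) = terms a m i @ [(Suc i, ?q)]"
      using c by (simp_all add: terms_def)
  qed
  show ?thesis
  proof (cases "?q \<in> set ys")
    case True
    \<comment> \<open>The zigzag edge is the northernmost one on its line, hence the head of
      \<open>ys\<close>. Its row directly follows \<open>terms a m i\<close>, so moving it to the
      ended paths leaves the list of rows unchanged.\<close>
    then obtain y ys' where ys: "ys = y # ys'" by (cases ys) auto
    then have "y = ?q" using True rest(2)[of y] assms(4,5) by auto
    then have ys: "ys = ?q # ys'" using ys by simp
    have sub: "set ys' \<subseteq> urows a m N (Suc i)" "?q \<notin> urows a m N (Suc i)"
      using assms(4,5) rest q ys by auto
    have "M (reg a m N i {} (set ys)) = M (reg a m N (Suc i) (set ys \<inter> urows a m N (Suc i)) {})"
      using assms(5) rest True by (intro strip_forced) auto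
    also have "set ys \<inter> urows a m N (Suc i) = set ys'"
      using sub ys by auto
    also have "real (M (reg a m N (Suc i) (set ys') {})) = state_det a m (Suc i) ys' []"
      by (rule IH) (use sub assms(4,6) ys terms in auto)
    finally show ?thesis using ys terms by (simp add: state_det_def)
  next
    case False
    have "M (reg a m N i {} (set ys)) = 0"
    proof (rule M_no_neighbour)
      show "down i ?q \<in> reg a m N i {} (set ys)" using q False by (auto simp: reg_def)
      show "\<not> share_edge (down i ?q) t" if "t \<in> reg a m N i {} (set ys)" for t
        using that rest(1)[OF q] by (auto simp: reg_def later_def)
    qed (simp add: finite_reg)
    \<comment> \<open>Nothing reaches the end \<open>c\<close>: ended paths cannot, and all current
      edges lie south of it.\<close>
    moreover have "state_det a m i [] ys = 0"
      unfolding state_det_def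
    proof (rule rows_det_zero_col[of c])
      fix f assume "f \<in> set (map (wt a m) (terms a m i @ map (Pair i) [] @ map (Pair (Suc i)) ys))"
      then consider c' where "c' < c" "f = wt a m (a + c', 2 * c' + 1)"
        | y where "y \<in> set ys" "f = wt a m (Suc i, y)"
        by (auto simp: terms)
      then show "f c = 0"
      proof cases
        case 2
        then have "?q < y" using rest(2)[of y] assms(5) False by (metis le_neq_implies_less subsetD)
        then show ?thesis using 2 by (simp add: wt_def)
      qed (simp add: wt_terminal)
    qed (use c assms(2,6) in auto)
    ultimately show ?thesis by simp
  qed
next
  case False
  \<comment> \<open>No zigzag edge lies on line i + 1, so every downward triangle has its eastern
    neighbour.\<close>
  have sub: "drows a m N i \<subseteq> urows a m N (Suc i)"
    using False by (auto simp: drows_def urows_def)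
  have terms: "terms a m (Suc i) = terms a m i"
    using False by (auto simp: terms_def min_def)
  have "M (reg a m N i {} (set ys)) = M (reg a m N (Suc i) (set ys \<inter> urows a m N (Suc i)) {})"
    using assms(5) sub by (intro strip_forced) auto
  also have "set ys \<inter> urows a m N (Suc i) = set ys" using assms(5) sub by auto
  also have "real (M (reg a m N (Suc i) (set ys) {})) = state_det a m (Suc i) ys []"
    by (rule IH) (use assms sub terms in auto)
  finally show ?thesis by (simp add: state_det_def terms)
qed

text \<open>Induction on the number of remaining lines, expanding and then finishing one strip. The
  row count \<open>S\<close> is the same on all lines; S > m is allowed for the case a = 0 with a
  dent at the first edge.\<close>

lemma M_reg:
  assumes "m \<le> N" "sorted_wrt (<) xs" "set xs \<subseteq> urows a m N i"
    and "length (terms a m i) + length xs = S" "m \<le> S"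
  shows "real (M (reg a m N i (set xs) {})) = state_det a m i xs []"
  using assms(2-4)
proof (induction "a + m - i" arbitrary: i xs)
  case 0
  then have "a + m \<le> i" by simp
  then have xs: "xs = []" using 0(3) rows_bounds(1)[of "hd xs" a m N i] by (cases xs) auto
  then have "real (M (reg a m N i (set xs) {})) = 1"
    using reg_beyond_end[OF \<open>a + m \<le> i\<close>] by simp
  moreover have "terms a m i = map (\<lambda>c. (a + c, 2 * c + 1)) [0..<m]"
    using \<open>a + m \<le> i\<close> by (simp add: terms_def min_def)
  ultimately show ?case using rows_det_terms xs by (simp add: state_det_def)
next
  case (Suc k)
  have IH: "real (M (reg a m N (Suc i) (set zs) {})) = state_det a m (Suc i) zs []"
    if "sorted_wrt (<) zs" "set zs \<subseteq> urows a m N (Suc i)" "length (terms a m (Suc i)) + length zs = S"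
    for zs
    by (rule Suc.hyps(1)[OF _ that]) (use Suc.hyps(2) in simp)
  have base: "real (M (reg a m N i {} (set ys))) = state_det a m i [] ys"
    if "sorted_wrt (<) ys" "set ys \<subseteq> drows a m N i" "length (terms a m i) + length ys = S" for ys
    by (rule strip_finish[OF IH assms(5,1) that])
  have "real (M (reg a m N i (set xs) (set []))) = state_det a m i xs []"
    by (rule strip_expand[OF base]) (use Suc.prems in auto)
  then show ?case by simp
qed

section \<open>Dependence of the determinant on the length of the northern side\<close>

text \<open>For z = x(1 + x) this compares coefficients of x^(2k - r - 2) in the second derivative
  of z^k. Absorption turns both binomials on the right into multiples of \<open>k choose r\<close>,
  leaving a polynomial identity.\<close>

lemma binomial_second_order:
  assumes "1 \<le> k"
  shows "(2 * real k - 1 - real r) * (2 * real k - real r) * real (k choose r) =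
     2 * real k * (2 * real k - 1) * real ((k - 1) choose r) +
     (if r < 2 then 0 else real k * (real k - 1) * real ((k - 2) choose (r - 2)))"
proof -
  have comp: "real k * real ((k - 1) choose r) = (real k - real r) * real (k choose r)"
  proof (cases "r \<le> k")
    case True
    then show ?thesis using arg_cong[OF binomial_absorb_comp[of k r], of real] by (simp add: of_nat_diff)
  qed (simp add: binomial_eq_0)
  have low: "(if r < 2 then 0 else real k * (real k - 1) * real ((k - 2) choose (r - 2))) =
      real r * (real r - 1) * real (k choose r)"
  proof (cases "r < 2")
    case True
    then have "r = 0 \<or> r = 1" by auto
    then show ?thesis by auto
  next
    case False
    then obtain s where r: "r = Suc (Suc s)" by (metis add_2_eq_Suc le_Suc_ex not_less)
    show ?thesis
    proof (cases "k = 1")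
      case True
      then show ?thesis using r by simp
    next
      case False
      then have "k = Suc (Suc (k - 2))" using assms by simp
      then obtain l where k: "k = Suc (Suc l)" by blast
      have absorb: "real (Suc n) * real (n choose t) = real (Suc n choose Suc t) * real (Suc t)" for n t
        by (simp only: of_nat_mult[symmetric] Suc_times_binomial_eq)
      have "K * L * Z = R * S * X" if "K * Y = X * R" "L * Z = Y * S" for K L R S X Y Z :: real
      proof -
        have "K * L * Z = K * (L * Z)" by simp
        also have "\<dots> = (K * Y) * S" unfolding that(2) by simp
        also have "\<dots> = R * S * X" unfolding that(1) by simp
        finally show ?thesis .
      qed
      note eq = this[OF absorb[of "Suc l" "Suc s"] absorb[of l s]]
      have "real k - 1 = real (Suc l)" "real r - 1 = real (Suc s)" "k - 2 = l" "r - 2 = s"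
        by (simp_all add: r k)
      then show ?thesis using \<open>\<not> r < 2\<close> eq[folded r k] by (simp only: if_False)
    qed
  qed
  have "2 * real k * (2 * real k - 1) * real ((k - 1) choose r) =
      2 * (2 * real k - 1) * ((real k - real r) * real (k choose r))"
    unfolding comp[symmetric] by simp
  then show ?thesis
    unfolding low by (simp add: algebra_simps)
qed

text \<open>For p \<ge> 1 this is the coefficient of x^(p + 2a - 1) in (x(1 + x))^(a + c).\<close>

definition ent :: "nat \<Rightarrow> nat \<Rightarrow> nat \<Rightarrow> real" where
  "ent a p c = (if p \<le> 2 * c + 1 then real ((a + c) choose (2 * c + 1 - p)) else 0)"

text \<open>This is the coefficient of \<open>x ^ (p + 2 * a - 1)\<close> in the second derivative of \<open>z ^ k\<close>, where \<open>z = x * (1 + x)\<close>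
  and \<open>k = a + c + 1\<close>: as \<open>z' ^ 2 = 4 * z + 1\<close>, it equals \<open>2 k (2 k - 1) z ^ (k - 1) + k (k - 1) z ^ (k - 2)\<close>.\<close>

lemma ent_Suc:
  assumes "1 \<le> p"
  shows "(real p + 2 * real a) * (real p + 2 * real a + 1) * ent (Suc a) p c =
    (2 * real a + 2 * real c + 1) * (2 * real a + 2 * real c + 2) * ent a p c +
    (if c = 0 then 0 else (real a + real c + 1) * (real a + real c) * ent a p (c - 1))"
proof (cases "p \<le> 2 * c + 1")
  case True
  define r where "r = 2 * c + 1 - p"
  have p: "real p = 2 * real c + 1 - real r" using True by (simp add: r_def)
  have "(if r < 2 then 0 else (a + c + 1) * (real (a + c + 1) - 1) * real ((a + c + 1 - 2) choose (r - 2))) =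
      (if c = 0 then 0 else (real a + real c + 1) * (real a + real c) * ent a p (c - 1))"
  proof (cases "r < 2")
    case True
    \<comment> \<open>For c > 0, r < 2 means p > 2(c - 1) + 1, so both sides vanish
      together.\<close>
    then show ?thesis using assms by (auto simp: ent_def r_def)
  next
    case False
    then have "c \<noteq> 0" "2 * (c - 1) + 1 - p = r - 2" "p \<le> 2 * (c - 1) + 1" "a + (c - 1) = a + c + 1 - 2"
      using assms by (auto simp: r_def)
    then show ?thesis using False by (simp add: ent_def algebra_simps)
  qed
  then have "(2 * real (a + c + 1) - 1 - real r) * (2 * real (a + c + 1) - real r) * real ((a + c + 1) choose r) =
      2 * real (a + c + 1) * (2 * real (a + c + 1) - 1) * real ((a + c + 1 - 1) choose r) +
      (if c = 0 then 0 else (real a + real c + 1) * (real a + real c) * ent a p (c - 1))"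
    using binomial_second_order[of "a + c + 1" r] by (simp only: le_add2)
  moreover have "real ((a + c + 1) choose r) = ent (Suc a) p c" "real ((a + c + 1 - 1) choose r) = ent a p c"
    using True by (simp_all add: ent_def r_def)
  moreover have "real (a + c + 1) = real a + real c + 1" by simp
  moreover have "(real p + 2 * real a) * (real p + 2 * real a + 1) * X =
      (2 * real a + 2 * real c + 1) * (2 * real a + 2 * real c + 2) * Y + Z"
    if "(2 * (real a + real c + 1) - 1 - real r) * (2 * (real a + real c + 1) - real r) * X =
      2 * (real a + real c + 1) * (2 * (real a + real c + 1) - 1) * Y + Z" for X Y Z
    using that unfolding p by (simp add: algebra_simps)
  ultimately show ?thesis by (simp only:)
next
  case False
  then show ?thesis by (auto simp: ent_def)
qed

definition dent_det :: "nat list \<Rightarrow> nat \<Rightarrow> real" where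
  "dent_det ps a = rows_det (map (ent a) ps)"

text \<open>By \<open>ent_Suc\<close> the rescaled matrix for a + 1 is the matrix for a times an
  upper bidiagonal one, so only the coefficients of \<open>ent a p c\<close> survive in the
  determinant.\<close>

lemma dent_det_Suc:
  assumes "\<And>p. p \<in> set ps \<Longrightarrow> 1 \<le> p"
  shows "(\<Prod>p\<leftarrow>ps. (real p + 2 * real a) * (real p + 2 * real a + 1)) * dent_det ps (Suc a) =
    dent_det ps a * (\<Prod>c<length ps. (2 * real a + 2 * real c + 1) * (2 * real a + 2 * real c + 2))"
proof -
  let ?T = "\<lambda>d c. if d = c then (2 * real a + 2 * real c + 1) * (2 * real a + 2 * real c + 2)
    else if Suc d = c then (real a + real c + 1) * (real a + real c) else 0"
  let ?f = "\<lambda>p c. (real p + 2 * real a) * (real p + 2 * real a + 1) * ent (Suc a) p c"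
  have "rows_det (map ?f ps) = rows_det (map (ent a) ps) * (\<Prod>c<length ps. ?T c c)"
  proof (rule rows_det_column_ops[where T = ?T])
    fix p c assume p: "p \<in> set ps" and c: "c < length ps"
    show "?f p c = (\<Sum>d<length ps. ent a p d * ?T d c)"
    proof (cases c)
      case 0
      have "(\<Sum>d<length ps. ent a p d * ?T d c) = (\<Sum>d\<in>{c}. ent a p d * ?T d c)"
        using c 0 by (intro sum.mono_neutral_right) auto
      then show ?thesis using ent_Suc[of p a c] assms[OF p] 0 by (simp add: algebra_simps)
    next
      case (Suc c')
      have "(\<Sum>d<length ps. ent a p d * ?T d c) = (\<Sum>d\<in>{c, c'}. ent a p d * ?T d c)"
        using c Suc by (intro sum.mono_neutral_right) auto
      then show ?thesis using ent_Suc[of p a c] assms[OF p] Suc by (simp add: algebra_simps)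
    qed
  qed auto
  then show ?thesis
    using rows_det_scale[of "\<lambda>p. (real p + 2 * real a) * (real p + 2 * real a + 1)" "ent (Suc a)" ps]
    by (simp add: dent_det_def)
qed

lemma prod_list_mult:
  "(\<Prod>x\<leftarrow>xs. f x * g x) = (\<Prod>x\<leftarrow>xs. f x) * (\<Prod>x\<leftarrow>xs. g x :: 'a :: comm_monoid_mult)"
  by (induction xs) (simp_all add: mult_ac)

lemma dent_det_eq:
  assumes "\<And>p. p \<in> set ps \<Longrightarrow> 1 \<le> p"
  shows "(\<Prod>p\<leftarrow>ps. pochhammer (real p) (2 * a)) * dent_det ps a =
    dent_det ps 0 * (\<Prod>c<length ps. pochhammer (2 * real c + 1) (2 * a))"
proof (induction a)
  case 0
  then show ?case by (simp add: map_replicate_const)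
next
  case (Suc a)
  have poch: "pochhammer z (2 * Suc a) = pochhammer z (2 * a) * ((z + 2 * real a) * (z + 2 * real a + 1))"
    for z :: real
    by (simp add: pochhammer_Suc algebra_simps)
  have "(\<Prod>p\<leftarrow>ps. pochhammer (real p) (2 * Suc a)) * dent_det ps (Suc a) =
      (\<Prod>p\<leftarrow>ps. pochhammer (real p) (2 * a)) *
      ((\<Prod>p\<leftarrow>ps. (real p + 2 * real a) * (real p + 2 * real a + 1)) * dent_det ps (Suc a))"
    unfolding poch prod_list_mult by (simp only: mult.assoc)
  also have "\<dots> = (\<Prod>p\<leftarrow>ps. pochhammer (real p) (2 * a)) * dent_det ps a *
      (\<Prod>c<length ps. (2 * real a + 2 * real c + 1) * (2 * real a + 2 * real c + 2))"
    using dent_det_Suc[of ps a] assms by (simp add: mult.assoc)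
  also have "\<dots> = dent_det ps 0 * (\<Prod>c<length ps. pochhammer (2 * real c + 1) (2 * Suc a))"
    unfolding Suc.IH poch prod.distrib by (simp add: algebra_simps)
  finally show ?case .
qed

section \<open>Polynomiality in a\<close>

lemma ent_polynomial: "\<exists>q :: real poly. \<forall>a. ent a p c = poly q (real a)"
proof (cases "p \<le> 2 * c + 1")
  case True
  let ?r = "2 * c + 1 - p"
  \<comment> \<open>The lower index is independent of a, so the binomial is a product of
    \<open>?r\<close> linear factors in a, up to a constant.\<close>
  have "ent a p c = poly (Polynomial.smult (1 / fact ?r) (\<Prod>i = 0..<?r. [:real c - real i, 1:])) (real a)" for a
    using True by (simp add: ent_def binomial_gbinomial gbinomial_prod_rev poly_prod algebra_simps)
  then show ?thesis by blast
next
  case False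
  then show ?thesis by (intro exI[of _ 0]) (simp add: ent_def)
qed

lemma dent_det_polynomial: "\<exists>q :: real poly. \<forall>a. dent_det ps a = poly q (real a)"
proof -
  obtain Q where Q: "\<And>p c a. ent a p c = poly (Q p c) (real a)"
    using ent_polynomial by metis
  show ?thesis
    by (rule exI[of _ "\<Sum>\<pi> | \<pi> permutes {0..<length ps}.
          [:signof \<pi>:] * (\<Prod>k = 0..<length ps. Q (ps ! k) (\<pi> k))"])
      (simp add: dent_det_def rows_det_leibniz Q poly_sum poly_prod)
qed

text \<open>Both \<open>P_vert a 0\<close> and \<open>P_vert a 1\<close> are 1 by truncated
  subtraction, so the induction starts at m = 1. A step then has to turn (j + 1)_{2a} into (2j +
  1)_{2a}, where j = k + 1.\<close>

lemma P_vert_eq: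
  "P_vert a m * (\<Prod>q = 1..m. pochhammer (real q) (2 * a)) = (\<Prod>c<m. pochhammer (2 * real c + 1) (2 * a))"
proof (cases m)
  case 0
  then show ?thesis by (simp add: P_vert_def)
next
  case (Suc k)
  define G where "G j = (\<Prod>i = 1..j. (2 * real a + real i + real j - 1) / (real i + real j - 1))" for j
  have P: "P_vert a (Suc l) = pochhammer (real a + 1) l / pochhammer (2 * real a + 1) l * prod G {1..l}" for l
    by (simp add: P_vert_def G_def)
  have "P_vert a (Suc k) * (\<Prod>q = 1..Suc k. pochhammer (real q) (2 * a)) =
      (\<Prod>c<Suc k. pochhammer (2 * real c + 1) (2 * a))"
  proof (induction k)
    case 0
    then show ?case by (simp add: P_vert_def)
  next
    case (Suc k)
    define j where "j = real k + 1"
    have j: "j > 0" by (simp add: j_def)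
    have G: "G (Suc k) = pochhammer (2 * real a + j) (Suc k) / pochhammer j (Suc k)"
      unfolding G_def prod_dividef pochhammer_prod
      by (intro arg_cong2[of _ _ _ _ "(/)"] prod.reindex_bij_witness[of _ Suc "\<lambda>i. i - 1"])
        (auto simp: j_def of_nat_diff)
    have P_step: "P_vert a (Suc (Suc k)) = P_vert a (Suc k) *
        ((real a + j) / (2 * real a + j) * (pochhammer (2 * real a + j) (Suc k) / pochhammer j (Suc k)))"
    proof -
      have "prod G {1..Suc k} = prod G {1..k} * G (Suc k)" by simp
      then show ?thesis
        unfolding P G by (simp add: pochhammer_Suc[of _ k] j_def add_ac mult_ac)
    qed
    have factor: "(real a + j) / (2 * real a + j) * (pochhammer (2 * real a + j) (Suc k) / pochhammer j (Suc k)) *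
        pochhammer (j + 1) (2 * a) = pochhammer (2 * j + 1) (2 * a)"
    proof -
      \<comment> \<open>Two ways of splitting (j)_{2a + k + 1}; the second tail starts at j + (k +
        1) = 2j.\<close>
      have 1: "pochhammer j (2 * a) * pochhammer (2 * real a + j) (Suc k) =
          pochhammer j (Suc k) * pochhammer (2 * j) (2 * a)"
        using pochhammer_product'[of j "2 * a" "Suc k"] pochhammer_product'[of j "Suc k" "2 * a"]
        by (simp add: j_def algebra_simps del: pochhammer_Suc)
      have 2: "z * pochhammer (z + 1) (2 * a) = pochhammer z (2 * a) * (z + 2 * real a)" for z :: real
        using pochhammer_rec[of z "2 * a"] pochhammer_rec'[of z "2 * a"] by (simp add: algebra_simps)
      have pos: "pochhammer j (Suc k) > 0" "2 * real a + j > 0" "j > 0"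
        using j by (auto intro: pochhammer_pos)
      \<comment> \<open>The extra factor j lets fact \<open>2\<close> shift (j + 1)_{2a} back to
        (j)_{2a}.\<close>
      have "j * ((real a + j) * pochhammer (2 * real a + j) (Suc k) * pochhammer (j + 1) (2 * a)) =
          j * ((2 * real a + j) * pochhammer j (Suc k) * pochhammer (2 * j + 1) (2 * a))"
      proof -
        have *: "j * ((x + j) * B * A') = j * ((2 * x + j) * C * E)"
          if "A * B = C * D" "j * A' = A * (j + 2 * x)" "2 * j * E = D * (2 * j + 2 * x)"
          for A A' B C D E x :: real
        proof -
          have "2 * (j * ((x + j) * B * A')) = 2 * (x + j) * B * (j * A')" by simp
          also have "\<dots> = 2 * (x + j) * (j + 2 * x) * (A * B)" unfolding that(2) by simp
          also have "\<dots> = (2 * x + j) * C * (D * (2 * j + 2 * x))" unfolding that(1) by (simp add: algebra_simps)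
          also have "\<dots> = 2 * (j * ((2 * x + j) * C * E))" unfolding that(3)[symmetric] by simp
          finally show ?thesis by simp
        qed
        show ?thesis by (rule *[OF 1 2[of j] 2[of "2 * j"]])
      qed
      then have eq: "(real a + j) * pochhammer (2 * real a + j) (Suc k) * pochhammer (j + 1) (2 * a) =
          (2 * real a + j) * pochhammer j (Suc k) * pochhammer (2 * j + 1) (2 * a)"
        using \<open>j > 0\<close> by simp
      have "(real a + j) / (2 * real a + j) * (pochhammer (2 * real a + j) (Suc k) / pochhammer j (Suc k)) *
          pochhammer (j + 1) (2 * a) = ((real a + j) * pochhammer (2 * real a + j) (Suc k) *
          pochhammer (j + 1) (2 * a)) / ((2 * real a + j) * pochhammer j (Suc k))"
        by simp
      also have "\<dots> = pochhammer (2 * j + 1) (2 * a)"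
        unfolding eq using pos by simp
      finally show ?thesis .
    qed
    define Q where "Q = (real a + j) / (2 * real a + j) *
      (pochhammer (2 * real a + j) (Suc k) / pochhammer j (Suc k))"
    have "P_vert a (Suc (Suc k)) * (\<Prod>q = 1..Suc (Suc k). pochhammer (real q) (2 * a)) =
        P_vert a (Suc k) * Q * ((\<Prod>q = 1..Suc k. pochhammer (real q) (2 * a)) * pochhammer (j + 1) (2 * a))"
      unfolding P_step Q_def by (simp add: j_def add_ac)
    also have "\<dots> = (P_vert a (Suc k) * (\<Prod>q = 1..Suc k. pochhammer (real q) (2 * a))) *
        (Q * pochhammer (j + 1) (2 * a))"
      by (simp only: mult_ac)
    also have "\<dots> = (\<Prod>c<Suc (Suc k). pochhammer (2 * real c + 1) (2 * a))"
      unfolding Suc.IH factor[folded Q_def] by (simp add: j_def algebra_simps)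
    finally show ?case .
  qed
  then show ?thesis using Suc by simp
qed

section \<open>The dented half hexagon\<close>

text \<open>Northeastern dents do not matter west of the axis: their eastern corners have abscissa
  2a + u k / 2 > a. The eastern bounds of the hexagon follow from lying west of the axis.\<close>

lemma up_in_V_iff:
  assumes "\<And>k. k \<in> {1..n} \<Longrightarrow> 1 \<le> u k"
  shows "up i p \<in> V a b n u \<longleftrightarrow> p \<in> urows a (b + n) (b + 2 * n) i \<and> \<not> (i = 0 \<and> p \<in> u ` {1..n})"
proof -
  have west: "xcoord (x, y) \<le> xcoord (int a, 0) \<longleftrightarrow> 2 * x + y \<le> 2 * int a" for x y
    unfolding xcoord_def by (simp add: field_simps) linarith
  show ?thesis
    unfolding V_def dented_hexagon_def hexagon_def hexagon_points_def ne_triangle_def nw_triangle_def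
      up_def urows_def
    using assms by (auto simp: west)
qed

lemma down_in_V_iff:
  "down i q \<in> V a b n u \<longleftrightarrow> q \<in> drows a (b + n) (b + 2 * n) i"
proof -
  have west: "xcoord (x, y) \<le> xcoord (int a, 0) \<longleftrightarrow> 2 * x + y \<le> 2 * int a" for x y
    unfolding xcoord_def by (simp add: field_simps) linarith
  show ?thesis
    unfolding V_def dented_hexagon_def hexagon_def hexagon_points_def ne_triangle_def nw_triangle_def
      down_def drows_def
    by (auto simp: west)
qed

lemma V_up_or_down:
  assumes "t \<in> V a b n u"
  shows "(\<exists>i p. t = up i p) \<or> (\<exists>i q. t = down i q)"
proof (cases t)
  case (Up i j)
  then have "i \<ge> 0" "j \<le> 0"
    using assms by (auto simp: V_def dented_hexagon_def hexagon_def hexagon_points_def)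
  then have "t = up (nat i) (nat (- j))" using Up by (simp add: up_def)
  then show ?thesis by blast
next
  case (Down i j)
  then have "i \<ge> 0" "j \<le> 0"
    using assms by (auto simp: V_def dented_hexagon_def hexagon_def hexagon_points_def)
  then have "t = down (nat i) (nat (- j))" using Down by (simp add: down_def)
  then show ?thesis by blast
qed

lemma V_eq_reg:
  assumes "\<And>k. k \<in> {1..n} \<Longrightarrow> 1 \<le> u k"
  shows "V a b n u = reg a (b + n) (b + 2 * n) 0 (urows a (b + n) (b + 2 * n) 0 - u ` {1..n}) {}"
    (is "_ = ?R")
proof (rule Set.set_eqI)
  fix t
  have V: "up i p \<in> V a b n u \<longleftrightarrow> p \<in> urows a (b + n) (b + 2 * n) i \<and> \<not> (i = 0 \<and> p \<in> u ` {1..n})"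
    for i p using assms by (rule up_in_V_iff)
  have "up i p \<in> V a b n u \<longleftrightarrow> up i p \<in> ?R" for i p
    unfolding V by (cases "i = 0") (auto simp: reg_def later_iff)
  moreover have "down i p \<in> V a b n u \<longleftrightarrow> down i p \<in> ?R" for i p
    by (cases "i = 0") (auto simp: down_in_V_iff reg_def later_iff)
  moreover have "(\<exists>i p. t = up i p) \<or> (\<exists>i q. t = down i q)" if "t \<in> ?R"
    using that by (auto simp: reg_def later_def)
  ultimately show "t \<in> V a b n u \<longleftrightarrow> t \<in> ?R" using V_up_or_down[of t a b n u] by blast
qed

lemma wt_line_0: "c < m \<Longrightarrow> wt a m (0, p) c = ent a p c"
  by (simp add: wt_def ent_def)

text \<open>For \<open>a = 0\<close> the western end of the zigzag is the first edge of the northwest side. If that edge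
  is dented, there is one path more than there are ends, so both sides vanish.\<close>

lemma M_V:
  assumes "inj_on u {1..n}" "\<And>k. k \<in> {1..n} \<Longrightarrow> 1 \<le> u k \<and> u k \<le> b + 2 * n"
  shows "real (M (V a b n u)) = dent_det (sorted_list_of_set ({1..b + 2 * n} - u ` {1..n})) a"
proof -
  define m N where "m = b + n" and "N = b + 2 * n"
  define ps where "ps = sorted_list_of_set ({1..N} - u ` {1..n})"
  have sub: "u ` {1..n} \<subseteq> {1..N}" using assms(2) by (auto simp: N_def)
  have set_ps: "set ps = {1..N} - u ` {1..n}" and sorted: "sorted_wrt (<) ps"
    by (simp_all add: ps_def)
  have len: "length ps = m"
    using card_image[OF assms(1)] card_Diff_subset[OF _ sub] by (simp add: ps_def m_def N_def)
  have "m \<le> N" and N: "N \<le> 2 * m" by (simp_all add: m_def N_def)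
  have MV: "M (V a b n u) = M (reg a m N 0 (urows a m N 0 - u ` {1..n}) {})"
    using V_eq_reg[of n u a b] assms(2) by (simp add: m_def N_def)
  have det: "dent_det ps a = rows_det (map (wt a m) (map (Pair 0) ps))"
    unfolding dent_det_def by (rule rows_det_cong) (auto simp: len wt_line_0)
  have "real (M (V a b n u)) = dent_det ps a"
  proof (cases "a = 0 \<and> m > 0")
    case False
    have "urows a m N 0 = {1..N}" using False N by (auto simp: urows_def)
    then have "real (M (V a b n u)) = real (M (reg a m N 0 (set ps) {}))"
      by (simp add: MV set_ps)
    also have "\<dots> = state_det a m 0 ps []"
      by (rule M_reg[OF \<open>m \<le> N\<close> sorted, of _ _ m])
        (use False N len set_ps in \<open>auto simp: terms_def urows_def\<close>)
    also have "terms a m 0 = []" using False by (auto simp: terms_def)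
    then have "state_det a m 0 ps [] = dent_det ps a" by (simp add: state_det_def det)
    finally show ?thesis .
  next
    case True
    then have a: "a = 0" "m > 0" by auto
    \<comment> \<open>For a = 0 the upward triangle in row 1 crosses the axis.\<close>
    have U: "urows a m N 0 = {2..N}" using a N by (auto simp: urows_def)
    have terms: "terms a m 0 = [(0, 1)]" using a by (simp add: terms_def)
    show ?thesis
    proof (cases "1 \<in> set ps")
      case True
      then obtain p ps' where ps: "ps = p # ps'" by (cases ps) auto
      then have "p = 1" using True sorted set_ps by force
      have ps: "ps = 1 # ps'" using ps \<open>p = 1\<close> by simp
      have set': "set ps' = urows a m N 0 - u ` {1..n}"
      proof -
        have "1 \<notin> set ps'" using sorted by (auto simp: ps)
        then have "set ps' = set ps - {1}" by (auto simp: ps)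
        also have "\<dots> = {2..N} - u ` {1..n}" unfolding set_ps by auto
        finally show ?thesis using U by simp
      qed
      then have "real (M (V a b n u)) = real (M (reg a m N 0 (set ps') {}))" by (simp add: MV)
      also have "\<dots> = state_det a m 0 ps' []"
        by (rule M_reg[OF \<open>m \<le> N\<close>, of _ _ _ m]) (use sorted len set' ps terms in auto)
      also have "\<dots> = dent_det ps a" unfolding det by (simp add: state_det_def terms ps)
      finally show ?thesis .
    next
      case False
      have set': "set ps = urows a m N 0 - u ` {1..n}"
      proof -
        have "set ps = set ps - {1}" using False by simp
        also have "\<dots> = {2..N} - u ` {1..n}" unfolding set_ps by auto
        finally show ?thesis using U by simp
      qed
      then have "real (M (V a b n u)) = real (M (reg a m N 0 (set ps) {}))" by (simp add: MV)
      also have "\<dots> = state_det a m 0 ps []"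
        \<comment> \<open>The ended path at (0, 1) adds a row to the m rows of \<open>ps\<close>, so
          the zero column \<open>m\<close> enters the matrix.\<close>
        by (rule M_reg[OF \<open>m \<le> N\<close> sorted, of _ _ "Suc m"]) (use len set' terms in auto)
      also have "\<dots> = 0"
        unfolding state_det_def by (rule rows_det_zero_col[of m]) (auto simp: len terms wt_def)
      also have "0 = dent_det ps a"
        unfolding dent_det_def
      proof (rule rows_det_zero_col[of 0, symmetric])
        fix f assume "f \<in> set (map (ent a) ps)"
        then obtain p where "p \<in> set ps" "f = ent a p" by auto
        then show "f 0 = 0" using False set_ps by (cases "p = 1") (auto simp: ent_def)
      qed (use a len in simp)
      finally show ?thesis .
    qed
  qed
  then show ?thesis by (simp add: ps_def N_def)
qed

text \<open>Both sides are \<open>(u)\<^sub>s\<^sub>+\<^sub>2\<^sub>a\<close> for \<open>u = u k\<close> and \<open>s = b + n + k - u k\<close>.\<close>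

lemma pochhammer_dents:
  assumes "strict_mono_on {1..n} u" "\<And>i. i \<in> {1..n} \<Longrightarrow> 1 \<le> u i \<and> u i \<le> b + 2 * n" "k \<in> {1..n}"
  shows "pochhammer (real (u k)) (underl b n u k) * pochhammer (real (b + n + k)) (2 * a) =
    pochhammer (real (u k)) (2 * a) * pochhammer (2 * real a + real (u k)) (underl b n u k)"
proof -
  \<comment> \<open>The n - k later dents need room below \<open>u k\<close>, so the subtraction in
    \<open>underl\<close> does not truncate.\<close>
  have "u k + d \<le> u (k + d)" if "k + d \<le> n" for d
    using that
  proof (induction d)
    case (Suc d)
    have "u (k + d) < u (k + Suc d)"
      using strict_mono_onD[OF assms(1), of "k + d" "k + Suc d"] assms(3) Suc.prems by simp
    then show ?case using Suc by simp
  qed simp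
  from this[of "n - k"] have "u k + (n - k) \<le> u n" using assms(3) by simp
  also have "u n \<le> b + 2 * n" using assms(2)[of n] assms(3) by simp
  finally have "u k \<le> b + n + k" using assms(3) by simp
  then have *: "real (u k) + real (underl b n u k) = real (b + n + k)"
    by (simp add: underl_def)
  show ?thesis
    using pochhammer_product'[of "real (u k)" "underl b n u k" "2 * a"]
      pochhammer_product'[of "real (u k)" "2 * a" "underl b n u k"]
    unfolding * by (simp add: add.commute)
qed

theorem mainTheorem4:
  fixes b n :: nat and u :: "nat \<Rightarrow> nat"
  assumes "strict_mono_on {1..n} u"
    and "\<And>i. i \<in> {1..n} \<Longrightarrow> 1 \<le> u i \<and> u i \<le> b + 2 * n"
  shows "(\<exists>p :: real poly. \<forall>a :: nat. real (M (V a b n u)) = poly p (real a)) \<and>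
    (\<forall>a :: nat. real (M (V a b n u)) =
       real (M (V 0 b n u)) *
       (\<Prod>i = 1..n. pochhammer (real (u i)) (underl b n u i)) *
       (P_vert a (b + n) /
         (\<Prod>i = 1..n. pochhammer (2 * real a + real (u i)) (underl b n u i))))"
proof -
  define m N where "m = b + n" and "N = b + 2 * n"
  define ps where "ps = sorted_list_of_set ({1..N} - u ` {1..n})"
  have inj: "inj_on u {1..n}" using assms(1) by (rule strict_mono_on_imp_inj_on)
  have sub: "u ` {1..n} \<subseteq> {1..N}" using assms(2) by (auto simp: N_def)
  have set_ps: "set ps = {1..N} - u ` {1..n}" "distinct ps" by (simp_all add: ps_def)
  have len: "length ps = m"
    using card_image[OF inj] card_Diff_subset[OF _ sub] by (simp add: ps_def m_def N_def)
  have count: "real (M (V a b n u)) = dent_det ps a" for a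
    unfolding ps_def N_def using inj assms(2) by (rule M_V)
  have "dent_det ps a = dent_det ps 0 * (\<Prod>i = 1..n. pochhammer (real (u i)) (underl b n u i)) *
      (P_vert a m / (\<Prod>i = 1..n. pochhammer (2 * real a + real (u i)) (underl b n u i)))" for a
  proof -
    define f where "f q = pochhammer (real q) (2 * a)" for q
    define A where "A = (\<Prod>p\<leftarrow>ps. f p)"
    define B where "B = prod f {1..m}"
    define E where "E = (\<Prod>i = 1..n. f (m + i))"
    define F where "F = (\<Prod>i = 1..n. f (u i))"
    define X where "X = (\<Prod>i = 1..n. pochhammer (real (u i)) (underl b n u i))"
    define Y where "Y = (\<Prod>i = 1..n. pochhammer (2 * real a + real (u i)) (underl b n u i))"
    have f: "f q > 0" if "q \<ge> 1" for q using that by (simp add: f_def pochhammer_pos)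
    have "E > 0" unfolding E_def by (intro prod_pos) (auto intro: f)
    have A: "A = prod f ({1..N} - u ` {1..n})"
      unfolding A_def set_ps(1)[symmetric] by (rule prod.distinct_set_conv_list[OF set_ps(2), symmetric])
    then have "A > 0" by (auto intro!: prod_pos f)
    have "Y > 0" unfolding Y_def using assms(2) by (intro prod_pos pochhammer_pos) (force intro: add_nonneg_pos)
    have det: "A * dent_det ps a = dent_det ps 0 * (P_vert a m * B)"
      using dent_det_eq[of ps a] set_ps(1) unfolding P_vert_eq len A_def B_def f_def by simp
    have XE: "X * E = F * Y"
      unfolding X_def E_def F_def Y_def prod.distrib[symmetric] f_def m_def
      by (intro prod.cong refl pochhammer_dents assms)
    \<comment> \<open>Both sides are the product of \<open>f\<close> over all N = m + n rows, split
      into undented and dented rows or into the first m and the last n.\<close>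
    have AF: "A * F = B * E"
    proof -
      have "F = prod f (u ` {1..n})" unfolding F_def prod.reindex[OF inj] by simp
      then have "A * F = prod f {1..N}" unfolding A using prod.subset_diff[OF sub, of f] by simp
      also have "\<dots> = prod f {1..m} * prod f {m + 1..m + n}"
      proof -
        have "N = m + n" by (simp add: N_def m_def)
        moreover have "prod f {1..m + n} = prod f {1..m} * prod f {m + 1..m + n}"
          by (rule prod.ub_add_nat) simp
        ultimately show ?thesis by simp
      qed
      also have "prod f {m + 1..m + n} = E"
        unfolding E_def by (rule prod.reindex_bij_witness[of _ "\<lambda>i. m + i" "\<lambda>q. q - m"]) auto
      finally show ?thesis by (simp add: B_def)
    qed
    have "(A * E) * (dent_det ps a * Y) = dent_det ps 0 * P_vert a m * Y * (B * E)"
      using arg_cong[OF det, of "\<lambda>z. z * (E * Y)"] by (simp add: mult_ac)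
    also have "\<dots> = dent_det ps 0 * P_vert a m * A * (F * Y)"
      unfolding AF[symmetric] by (simp add: mult_ac)
    also have "\<dots> = (A * E) * (dent_det ps 0 * X * P_vert a m)"
      unfolding XE[symmetric] by (simp add: mult_ac)
    finally have "dent_det ps a * Y = dent_det ps 0 * X * P_vert a m"
      using \<open>A > 0\<close> \<open>E > 0\<close> by simp
    then show ?thesis
      unfolding X_def[symmetric] Y_def[symmetric] using \<open>Y > 0\<close> by (simp add: field_simps)
  qed
  then show ?thesis
    unfolding count m_def[symmetric] using dent_det_polynomial[of ps] by blast
qed

end
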